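(* Let $K\ge 1$ and consider the binary-symmetric parallel-relay (BSPR) network with $K$ relays and cross-over probabilities $p_{s,i},p_{i,d}\in[0,\tfrac12]$, $i=1,\dots,K$. For any nonempty $\mathcal M=\{m_1,\dots,m_M\}\subseteq\{1,\dots,K\}$ and any distribution of the form $$p(u)\prod_{i=1}^M p(v_{m_i}|u)\; p(x_{m_1})p(x_{m_2})\cdots p(x_{m_M})\prod_{j=1}^M p(y_{m_j}|x_{m_j}),$$ where $p(u),p(x_{m_1}),\dots,p(x_{m_M})$ are arbitrary distributions on $\{0,1\}$ and $p(v_{m_i}|u)$, $p(y_{m_j}|x_{m_j})$ are the network's channel transition probabilities, put $$R_{\mathrm D}=\min\Big\{\ \min_{1\le i\le M} I(U;V_{m_i}),\ \sum_{i=1}^M I(X_{m_i};Y_{m_i})\Big\}.$$ Then rates up to $R_{\mathrm D}$ are achievable in the network, i.e. every rate $R$ with $0\le R<R_{\mathrm D}$ is achievable.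
   Context: **The BSPR network.** There is one source, $K$ relays $1,\dots,K$, and one destination. All channel inputs, outputs and noises are binary, and $\oplus$ is addition modulo 2. At each time $t=1,2,\dots$ the source transmits $U[t]\in\{0,1\}$ and relay $i$ receives $V_i[t]=U[t]\oplus Z_i[t]$ with $\Pr\{Z_i[t]=1\}=p_{s,i}$; relay $i$ transmits $X_i[t]\in\{0,1\}$ and the destination receives, on a separate link for each $i$, $Y_i[t]=X_i[t]\oplus E_i[t]$ with $\Pr\{E_i[t]=1\}=p_{i,d}$. Here $0\le p_{s,i},p_{i,d}\le \tfrac12$. All the noises $Z_i[t],E_i[t]$ (over all $i,t$) are independent of each other and of the message. Thus the transition probability $p(v_i|u)$ equals $1-p_{s,i}$ if $v_i=u$ and $p_{s,i}$ otherwise, and $p(y_i|x_i)$ equals $1-p_{i,d}$ if $y_i=x_i$ and $p_{i,d}$ otherwise. **Codes and achievable rates.** A code of rate $R\ge 0$ and length $n$ has a message $W$ uniform on $\{0,1,\dots,\lceil 2^{nR}\rceil-1\}$, a source encoder giving $(U[1],\dots,U[n])$ as a function of $W$, for each relay $i$ and time $t\le n$ a function giving $X_i[t]$ from $(V_i[1],\dots,V_i[t-1])$, and a decoder giving $\hat W$ from $(Y_i[t])_{1\le i\le K,\,1\le t\le n}$. Its error probability is $P_e=\Pr\{\hat W\ne W\}$. A rate $R$ is achievable if for every $\epsilon>0$ and all sufficiently large $n$ there is a code of rate $R$ and length $n$ with $P_e<\epsilon$. $I(\cdot\,;\cdot)$ is mutual information with logarithms to base 2; rates are in bits per channel use. 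*)

theory Defs
  imports "HOL-Probability.Probability"
begin

text \<open>Bits are elements of \<^typ>\<open>bool\<close>, so addition modulo 2 of bits is \<open>\<noteq>\<close>.\<close>

definition bsc :: "real \<Rightarrow> bool \<Rightarrow> bool pmf" where
  "bsc p u = map_pmf (\<lambda>z. u \<noteq> z) (bernoulli_pmf p)"

lemma pmf_bsc:
  assumes "0 \<le> p" "p \<le> 1"
  shows "pmf (bsc p u) v = (if v = u then 1 - p else p)"
proof -
  have "pmf (map_pmf (\<lambda>z. u \<noteq> z) (bernoulli_pmf p)) (u \<noteq> (u \<noteq> v)) =
      pmf (bernoulli_pmf p) (u \<noteq> v)"
    by (rule pmf_map_inj') (auto simp: inj_on_def)
  moreover have "(u \<noteq> (u \<noteq> v)) = v"
    by auto
  ultimately have "pmf (bsc p u) v = pmf (bernoulli_pmf p) (u \<noteq> v)"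
    by (simp only: bsc_def)
  then show ?thesis
    using assms by (cases u; cases v) simp_all
qed

text \<open>
  In \<open>relay_enc c i t vs\<close> the list \<open>vs\<close> consists of the bits received by relay \<open>i\<close> at
  times \<open>1, \<dots>, t - 1\<close>, in this order; the destination sees the bit of relay \<open>i\<close> at time
  \<open>t\<close> as the entry \<open>(i, t)\<close>.
\<close>

record relay_code =
  source_enc :: "nat \<Rightarrow> nat \<Rightarrow> bool"
  relay_enc :: "nat \<Rightarrow> nat \<Rightarrow> bool list \<Rightarrow> bool"
  dest_dec :: "(nat \<times> nat \<Rightarrow> bool) \<Rightarrow> nat"

definition messages :: "nat \<Rightarrow> real \<Rightarrow> nat set" where
  "messages n R = {0..<nat \<lceil>2 powr (real n * R)\<rceil>}"

definition is_code :: "nat \<Rightarrow> real \<Rightarrow> relay_code \<Rightarrow> bool" where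
  "is_code n R c \<longleftrightarrow> range (dest_dec c) \<subseteq> messages n R"

definition relay_received ::
  "relay_code \<Rightarrow> nat \<Rightarrow> (nat \<times> nat \<Rightarrow> bool) \<Rightarrow> nat \<Rightarrow> nat \<Rightarrow> bool" where
  "relay_received c w z i t = (source_enc c w t \<noteq> z (i, t))"

definition relay_sent ::
  "relay_code \<Rightarrow> nat \<Rightarrow> (nat \<times> nat \<Rightarrow> bool) \<Rightarrow> nat \<Rightarrow> nat \<Rightarrow> bool" where
  "relay_sent c w z i t = relay_enc c i t (map (relay_received c w z i) [1..<t])"

definition dest_received ::
  "nat \<Rightarrow> nat \<Rightarrow> relay_code \<Rightarrow> nat \<Rightarrow> (nat \<times> nat \<Rightarrow> bool) \<Rightarrow> (nat \<times> nat \<Rightarrow> bool)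
    \<Rightarrow> nat \<times> nat \<Rightarrow> bool" where
  "dest_received K n c w z e =
     restrict (\<lambda>(i, t). relay_sent c w z i t \<noteq> e (i, t)) ({1..K} \<times> {1..n})"

definition noise_pmf :: "nat \<Rightarrow> nat \<Rightarrow> (nat \<Rightarrow> real) \<Rightarrow> (nat \<times> nat \<Rightarrow> bool) pmf" where
  "noise_pmf K n p = Pi_pmf ({1..K} \<times> {1..n}) False (\<lambda>(i, t). bernoulli_pmf (p i))"

definition error_prob ::
  "nat \<Rightarrow> (nat \<Rightarrow> real) \<Rightarrow> (nat \<Rightarrow> real) \<Rightarrow> nat \<Rightarrow> real \<Rightarrow> relay_code \<Rightarrow> real" where
  "error_prob K ps pd n R c =
     measure_pmf.prob
       (pair_pmf (pmf_of_set (messages n R)) (pair_pmf (noise_pmf K n ps) (noise_pmf K n pd)))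
       {(w, z, e). dest_dec c (dest_received K n c w z e) \<noteq> w}"

definition achievable :: "nat \<Rightarrow> (nat \<Rightarrow> real) \<Rightarrow> (nat \<Rightarrow> real) \<Rightarrow> real \<Rightarrow> bool" where
  "achievable K ps pd R \<longleftrightarrow>
     0 \<le> R \<and>
     (\<forall>\<epsilon>>0. \<forall>\<^sub>F n in sequentially. \<exists>c. is_code n R c \<and> error_prob K ps pd n R c < \<epsilon>)"

text \<open>
  The joint law of \<open>(U, V, X, Y)\<close> with \<open>V = (V\<^sub>m)\<close>, \<open>X = (X\<^sub>m)\<close>, \<open>Y = (Y\<^sub>m)\<close> for \<open>m \<in> M\<close>.
  Families are total functions that are \<^term>\<open>False\<close> outside \<open>M\<close>.
\<close>

definition joint_pmf ::
  "(nat \<Rightarrow> real) \<Rightarrow> (nat \<Rightarrow> real) \<Rightarrow> nat set \<Rightarrow> bool pmf \<Rightarrow> (nat \<Rightarrow> bool pmf)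
    \<Rightarrow> (bool \<times> (nat \<Rightarrow> bool) \<times> (nat \<Rightarrow> bool) \<times> (nat \<Rightarrow> bool)) pmf" where
  "joint_pmf ps pd M pu px =
     do {
       u \<leftarrow> pu;
       v \<leftarrow> Pi_pmf M False (\<lambda>m. bsc (ps m) u);
       x \<leftarrow> Pi_pmf M False px;
       y \<leftarrow> Pi_pmf M False (\<lambda>m. bsc (pd m) (x m));
       return_pmf (u, v, x, y)
     }"

lemma pmf_bind_Pair:
  "pmf (bind_pmf p (\<lambda>a. map_pmf (Pair a) (q a))) (a, b) = pmf p a * pmf (q a) b"
proof -
  have "pmf (map_pmf (Pair a') (q a')) (a, b) = indicator {a} a' * pmf (q a) b" for a'
  proof (cases "a' = a")
    case True
    then show ?thesis by (simp add: pmf_map_inj' inj_on_def)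
  next
    case False
    then have "(a, b) \<notin> set_pmf (map_pmf (Pair a') (q a'))" by auto
    then have "pmf (map_pmf (Pair a') (q a')) (a, b) = 0" by (simp only: pmf_eq_0_set_pmf not_False_eq_True)
    then show ?thesis using False by simp
  qed
  then show ?thesis by (simp add: pmf_bind measure_pmf_single)
qed

lemma pmf_joint_pmf:
  assumes "finite M" "\<And>m. m \<notin> M \<Longrightarrow> \<not> v m \<and> \<not> x m \<and> \<not> y m"
  shows "pmf (joint_pmf ps pd M pu px) (u, v, x, y) =
    pmf pu u * (\<Prod>m\<in>M. pmf (bsc (ps m) u) (v m)) * (\<Prod>m\<in>M. pmf (px m) (x m)) *
    (\<Prod>m\<in>M. pmf (bsc (pd m) (x m)) (y m))"
proof -
  have "joint_pmf ps pd M pu px =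
    bind_pmf pu (\<lambda>u. map_pmf (Pair u)
      (bind_pmf (Pi_pmf M False (\<lambda>m. bsc (ps m) u)) (\<lambda>v. map_pmf (Pair v)
        (bind_pmf (Pi_pmf M False px) (\<lambda>x. map_pmf (Pair x)
          (Pi_pmf M False (\<lambda>m. bsc (pd m) (x m))))))))"
    by (simp add: joint_pmf_def map_pmf_def bind_assoc_pmf bind_return_pmf)
  then show ?thesis
    using assms by (simp add: pmf_bind_Pair pmf_Pi' mult.assoc)
qed

definition mutual_info :: "'a pmf \<Rightarrow> ('a \<Rightarrow> bool) \<Rightarrow> ('a \<Rightarrow> bool) \<Rightarrow> real" where
  "mutual_info q A B =
     prob_space.mutual_information (measure_pmf q) 2 (count_space UNIV) (count_space UNIV) A B"

definition R_D ::
  "(nat \<Rightarrow> real) \<Rightarrow> (nat \<Rightarrow> real) \<Rightarrow> nat set \<Rightarrow> bool pmf \<Rightarrow> (nat \<Rightarrow> bool pmf) \<Rightarrow> real" where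
  "R_D ps pd M pu px =
     (let q = joint_pmf ps pd M pu px;
          U = (\<lambda>(u, v, x, y). u);
          V = (\<lambda>m (u, v, x, y). v m);
          X = (\<lambda>m (u, v, x, y). x m);
          Y = (\<lambda>m (u, v, x, y). y m)
      in min (Min ((\<lambda>m. mutual_info q U (V m)) ` M))
             (\<Sum>m\<in>M. mutual_info q (X m) (Y m)))"

end

theory Submission
  imports Defs
begin

text \<open>
  The mutual information over a binary symmetric channel is at most \<open>1 - H(p)\<close>, so
  uniform inputs suffice. The message is written in base \<open>Q \<approx> 2 powr (L * (R +
  \<eta>))\<close> with \<open>B\<close> digits, and time is cut into \<open>B + 1\<close>
  blocks of length \<open>L\<close>: the source sends digit \<open>b\<close> in block
  \<open>b\<close>, all relays in \<open>M\<close> decode it at the end of that block, and send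
  it jointly to the destination in block \<open>b + 1\<close>. Every receiver looks for the
  unique digit whose codeword differs from the received word by a typical noise word. True noise
  is typical up to probability \<open>O(1/L)\<close> by Chebyshev's inequality, and a wrong
  codeword, being uniform and independent of what was received, matches only with exponentially
  small probability because there are few typical words. The random coding average is taken over
  all messages at once, so digits need not be uniformly distributed.
\<close>

subsection \<open>Mutual information of a binary symmetric channel\<close>

text \<open>The convention 0 log 0 = 0 is built in, as the factor 0 wins whatever the value of
  \<open>log 2 0\<close>.\<close>

definition binary_entropy :: "real \<Rightarrow> real" where
  "binary_entropy p = - p * log 2 p - (1 - p) * log 2 (1 - p)"

text \<open>The function \<open>- x * log 2 x\<close> lies below its tangent at 1/2, and the tangent
  values at \<open>b\<close> and \<open>1 - b\<close> add up to 1.\<close>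

lemma binary_entropy_le_1:
  assumes "0 \<le> b" "b \<le> 1"
  shows "binary_entropy b \<le> 1"
proof -
  have *: "- x * log 2 x \<le> x + (1/2 - x) / ln 2" if "0 \<le> x" for x :: real
  proof (cases "x = 0")
    case False
    then have x: "0 < x" using that by simp
    \<comment> \<open>Concavity enters as \<open>ln y \<le> y - 1\<close> at
      \<open>y = 1 / (2 * x)\<close>, with equality at \<open>x = 1/2\<close>.\<close>
    have "x * ln (1 / (2 * x)) \<le> x * (1 / (2 * x) - 1)"
      using x by (intro mult_left_mono ln_le_minus_one) auto
    also have "\<dots> = 1/2 - x"
      using x by (simp add: field_simps)
    finally have "x * (- ln 2 - ln x) \<le> 1/2 - x"
      using x by (simp add: ln_div ln_mult)
    then have "x * (- ln 2 - ln x) / ln 2 \<le> (1/2 - x) / ln 2"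
      by (intro divide_right_mono) auto
    moreover have "x * (- ln 2 - ln x) / ln 2 = - x - x * log 2 x"
      by (simp add: log_def field_simps)
    ultimately show ?thesis by linarith
  qed auto
  have "binary_entropy b = - b * log 2 b + - (1 - b) * log 2 (1 - b)"
    by (simp add: binary_entropy_def algebra_simps)
  also have "\<dots> \<le> (b + (1/2 - b) / ln 2) + ((1 - b) + (1/2 - (1 - b)) / ln 2)"
    using assms by (intro add_mono *) auto
  also have "\<dots> = 1"
    by (simp add: field_simps)
  finally show ?thesis .
qed

section \<open>Mutual information of two bits as a finite sum\<close>

lemma distributed_measure_pmf:
  "distributed (measure_pmf q) (count_space UNIV) X (pmf (map_pmf X q))"
  unfolding distributed_def
  by (auto simp: measure_pmf_eq_density[symmetric] map_pmf_rep_eq)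

lemma mutual_info_eq_sum:
  fixes q :: "'a pmf"
  shows "mutual_info q A B = (\<Sum>(u, v)\<in>UNIV. pmf (map_pmf (\<lambda>\<omega>. (A \<omega>, B \<omega>)) q) (u, v) *
    log 2 (pmf (map_pmf (\<lambda>\<omega>. (A \<omega>, B \<omega>)) q) (u, v) / (pmf (map_pmf A q) u * pmf (map_pmf B q) v)))"
proof -
  interpret information_space "measure_pmf q" 2
    by unfold_locales simp
  have C: "count_space UNIV \<Otimes>\<^sub>M count_space UNIV = (count_space UNIV :: (bool \<times> bool) measure)"
    by (simp add: pair_measure_count_space)
  have "mutual_info q A B = (\<integral>x. pmf (map_pmf (\<lambda>\<omega>. (A \<omega>, B \<omega>)) q) x *
    log 2 (pmf (map_pmf (\<lambda>\<omega>. (A \<omega>, B \<omega>)) q) x / (pmf (map_pmf A q) (fst x) * pmf (map_pmf B q) (snd x)))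
       \<partial>(count_space UNIV \<Otimes>\<^sub>M count_space UNIV))"
    unfolding mutual_info_def
    by (rule mutual_information_distr)
       (auto simp: C distributed_measure_pmf intro!: sigma_finite_measure_count_space_finite)
  also have "\<dots> = (\<Sum>x\<in>UNIV. pmf (map_pmf (\<lambda>\<omega>. (A \<omega>, B \<omega>)) q) x *
    log 2 (pmf (map_pmf (\<lambda>\<omega>. (A \<omega>, B \<omega>)) q) x / (pmf (map_pmf A q) (fst x) * pmf (map_pmf B q) (snd x))))"
    unfolding C by (rule lebesgue_integral_count_space_finite) simp
  finally show ?thesis by (simp add: case_prod_beta)
qed

text \<open>This is I(A;B) = H(B) - H(B|A): given either input, the output has entropy H(p), and one
  output bit has entropy at most 1. The input law \<open>r\<close> is arbitrary.\<close>

lemma mutual_info_bsc_le: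
  fixes q :: "'a pmf"
  assumes AB: "map_pmf (\<lambda>\<omega>. (A \<omega>, B \<omega>)) q = bind_pmf r (\<lambda>u. map_pmf (Pair u) (bsc p u))"
    and p: "0 \<le> p" "p \<le> 1"
  shows "mutual_info q A B \<le> 1 - binary_entropy p"
proof -
  define W where "W u v = pmf (bsc p u) v" for u v
  define s where "s v = pmf r True * W True v + pmf r False * W False v" for v
  have rF: "pmf r False = 1 - pmf r True"
    by (rule pmf_False_conv_True)
  have A: "map_pmf A q = r"
  proof -
    have "map_pmf A q = map_pmf fst (map_pmf (\<lambda>\<omega>. (A \<omega>, B \<omega>)) q)"
      by (simp add: map_pmf_comp)
    also have "\<dots> = r"
      unfolding AB by (simp add: map_bind_pmf map_pmf_comp map_pmf_const bind_return_pmf')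
    finally show ?thesis .
  qed
  have "map_pmf B q = map_pmf snd (map_pmf (\<lambda>\<omega>. (A \<omega>, B \<omega>)) q)"
    by (simp add: map_pmf_comp)
  also have "\<dots> = bind_pmf r (bsc p)"
    unfolding AB by (simp add: map_bind_pmf map_pmf_comp)
  finally have B: "pmf (map_pmf B q) v = s v" for v
    by (simp add: pmf_bind s_def W_def integral_measure_pmf_real[where A = UNIV] UNIV_bool mult.commute)
  have nn: "0 \<le> pmf r u * W u v" for u v by (simp add: W_def)
  \<comment> \<open>Where the joint mass vanishes both sides are 0; elsewhere the input mass cancels
    and the logarithm splits.\<close>
  have "pmf r u * W u v * log 2 (pmf r u * W u v / (pmf r u * s v))
      = pmf r u * W u v * log 2 (W u v) - pmf r u * W u v * log 2 (s v)" for u v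
  proof (cases "pmf r u * W u v = 0")
    case False
    then have pos: "0 < pmf r u" "0 < W u v"
      using pmf_nonneg[of r u] pmf_nonneg[of "bsc p u" v] unfolding W_def by (auto simp: order_less_le)
    have "pmf r u * W u v \<le> s v"
      using nn by (cases u) (auto simp: s_def)
    then have "0 < s v" using pos by (smt (verit) mult_pos_pos)
    then show ?thesis using pos by (simp add: log_divide right_diff_distrib)
  qed auto
  then have "mutual_info q A B = (\<Sum>(u, v)\<in>UNIV. pmf r u * W u v * log 2 (W u v) - pmf r u * W u v * log 2 (s v))"
    unfolding mutual_info_eq_sum by (simp only: AB pmf_bind_Pair A[unfolded AB] A B W_def)
  \<comment> \<open>The \<open>W\<close> logarithms give -H(B|A), the same for both inputs; the
    \<open>s\<close> logarithms give the entropy of the output law \<open>s\<close>.\<close>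
  also have "\<dots> = - binary_entropy p + binary_entropy (s True)"
  proof -
    have sF: "s False = 1 - s True"
      using p by (simp add: s_def W_def pmf_bsc rF algebra_simps)
    have sum4: "(\<Sum>x\<in>UNIV. f x) = f (True, True) + f (True, False) + f (False, True) + f (False, False)"
      for f :: "bool \<times> bool \<Rightarrow> real"
      by (simp add: UNIV_Times_UNIV[symmetric] UNIV_bool sum.cartesian_product[symmetric] del: UNIV_Times_UNIV)
    have e: "binary_entropy (s True) = - s True * log 2 (s True) - s False * log 2 (s False)"
      unfolding binary_entropy_def sF ..
    show ?thesis
      unfolding sum4 e using p
      by (simp add: binary_entropy_def s_def W_def pmf_bsc rF algebra_simps)
  qed
  also have "binary_entropy (s True) \<le> 1"
    by (rule binary_entropy_le_1) (use B[of True] pmf_le_1[of "map_pmf B q" True] pmf_nonneg[of "map_pmf B q" True] in auto)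
  finally show ?thesis by simp
qed

text \<open>Every mutual information in the minimum belongs to the input and output of one binary
  symmetric channel. The input laws \<open>pu\<close> and \<open>px\<close> drop out, and the coding
  argument uses nothing else about \<open>R_D\<close>.\<close>

lemma R_D_le:
  assumes M: "finite M" "M \<noteq> {}"
    and ps: "\<And>i. i \<in> M \<Longrightarrow> 0 \<le> ps i \<and> ps i \<le> 1"
    and pd: "\<And>i. i \<in> M \<Longrightarrow> 0 \<le> pd i \<and> pd i \<le> 1"
  shows "\<And>i. i \<in> M \<Longrightarrow> R_D ps pd M pu px \<le> 1 - binary_entropy (ps i)"
    and "R_D ps pd M pu px \<le> (\<Sum>i\<in>M. 1 - binary_entropy (pd i))"
proof -
  define q where "q = joint_pmf ps pd M pu px"
  have UV: "mutual_info q (\<lambda>(u, v, x, y). u) (\<lambda>(u, v, x, y). v i) \<le> 1 - binary_entropy (ps i)"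
    if i: "i \<in> M" for i
  proof (rule mutual_info_bsc_le)
    have "map_pmf (\<lambda>\<omega>. (case \<omega> of (u, v, x, y) \<Rightarrow> u, case \<omega> of (u, v, x, y) \<Rightarrow> v i)) q =
      bind_pmf pu (\<lambda>u. map_pmf (Pair u) (map_pmf (\<lambda>v. v i) (Pi_pmf M False (\<lambda>m. bsc (ps m) u))))"
      by (simp add: q_def joint_pmf_def map_bind_pmf map_pmf_def[symmetric] map_pmf_comp)
    then show "map_pmf (\<lambda>\<omega>. (case \<omega> of (u, v, x, y) \<Rightarrow> u, case \<omega> of (u, v, x, y) \<Rightarrow> v i)) q =
      bind_pmf pu (\<lambda>u. map_pmf (Pair u) (bsc (ps i) u))"
      using M i by (simp add: Pi_pmf_component)
  qed (use ps i in auto)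
  have XY: "mutual_info q (\<lambda>(u, v, x, y). x i) (\<lambda>(u, v, x, y). y i) \<le> 1 - binary_entropy (pd i)"
    if i: "i \<in> M" for i
  proof (rule mutual_info_bsc_le)
    have "map_pmf (\<lambda>\<omega>. (case \<omega> of (u, v, x, y) \<Rightarrow> x i, case \<omega> of (u, v, x, y) \<Rightarrow> y i)) q =
      bind_pmf (Pi_pmf M False px)
        (\<lambda>x. map_pmf (Pair (x i)) (map_pmf (\<lambda>v. v i) (Pi_pmf M False (\<lambda>m. bsc (pd m) (x m)))))"
      by (simp add: q_def joint_pmf_def map_bind_pmf map_pmf_def[symmetric] map_pmf_comp)
    \<comment> \<open>The component \<open>y i\<close> depends on \<open>x\<close> only through
      \<open>x i\<close>, so the input vector can first be reduced to that component.\<close>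
    also have "\<dots> = bind_pmf (map_pmf (\<lambda>x. x i) (Pi_pmf M False px))
        (\<lambda>b. map_pmf (Pair b) (bsc (pd i) b))"
      using M i by (subst bind_map_pmf) (simp add: Pi_pmf_component)
    finally show "map_pmf (\<lambda>\<omega>. (case \<omega> of (u, v, x, y) \<Rightarrow> x i, case \<omega> of (u, v, x, y) \<Rightarrow> y i)) q =
      bind_pmf (px i) (\<lambda>u. map_pmf (Pair u) (bsc (pd i) u))"
      unfolding Pi_pmf_component[OF M(1)] if_P[OF i] .
  qed (use pd i in auto)
  have R: "R_D ps pd M pu px = min (Min ((\<lambda>m. mutual_info q (\<lambda>(u, v, x, y). u) (\<lambda>(u, v, x, y). v m)) ` M))
     (\<Sum>m\<in>M. mutual_info q (\<lambda>(u, v, x, y). x m) (\<lambda>(u, v, x, y). y m))"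
    by (simp add: R_D_def q_def Let_def)
  show "R_D ps pd M pu px \<le> 1 - binary_entropy (ps i)" if "i \<in> M" for i
  proof -
    have "R_D ps pd M pu px \<le> mutual_info q (\<lambda>(u, v, x, y). u) (\<lambda>(u, v, x, y). v i)"
      unfolding R using M that by (intro min.coboundedI1 Min_le) auto
    then show ?thesis using UV[OF that] by linarith
  qed
  show "R_D ps pd M pu px \<le> (\<Sum>i\<in>M. 1 - binary_entropy (pd i))"
    unfolding R by (intro min.coboundedI2 sum_mono XY)
qed

subsection \<open>Typical noise\<close>

text \<open>Splitting off coordinate \<open>j\<close> leaves a product law containing
  \<open>k\<close>. Pairwise independence serves twice: for the variance of the noise surprisals and
  for pairs of random codewords.\<close>

lemma Pi_pmf_pair_components:
  assumes "finite A" "j \<in> A" "k \<in> A" "j \<noteq> k"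
  shows "map_pmf (\<lambda>f. (f j, f k)) (Pi_pmf A d p) = pair_pmf (p j) (p k)"
proof -
  have "map_pmf (\<lambda>f. (f j, f k)) (Pi_pmf (insert j (A - {j})) d p) =
    map_pmf (\<lambda>(x, f). (id x, f k)) (pair_pmf (p j) (Pi_pmf (A - {j}) d p))"
    using assms by (subst Pi_pmf_insert) (auto simp: map_pmf_comp case_prod_unfold intro!: map_pmf_cong)
  also have "\<dots> = pair_pmf (map_pmf id (p j)) (map_pmf (\<lambda>f. f k) (Pi_pmf (A - {j}) d p))"
    by (rule map_pair)
  also have "\<dots> = pair_pmf (p j) (p k)"
    using assms by (simp add: Pi_pmf_component)
  finally show ?thesis
    using assms by (simp add: insert_absorb)
qed

definition surprisal :: "real \<Rightarrow> bool \<Rightarrow> real" where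
  "surprisal p z = - log 2 (pmf (bernoulli_pmf p) z)"

text \<open>For \<open>p\<close> between 0 and 1 this is the variance of the self-information of a
  noise bit, whose mean is \<open>binary_entropy p\<close>.\<close>

definition surprisal_var :: "real \<Rightarrow> real" where
  "surprisal_var p = measure_pmf.expectation (bernoulli_pmf p) (\<lambda>z. (surprisal p z - binary_entropy p)\<^sup>2)"

lemma expectation_surprisal:
  assumes "0 \<le> p" "p \<le> 1"
  shows "measure_pmf.expectation (bernoulli_pmf p) (\<lambda>z. surprisal p z - binary_entropy p) = 0"
  using assms by (simp add: surprisal_def binary_entropy_def algebra_simps)

text \<open>Expanding the square leaves only the diagonal: distinct coordinates are independent with
  mean 0, so mixed products have expectation 0.\<close>

lemma second_moment_sum_Pi_pmf:
  fixes g :: "'a \<Rightarrow> bool \<Rightarrow> real"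
  assumes D: "finite D" "J \<subseteq> D"
    and zero: "\<And>j. j \<in> J \<Longrightarrow> measure_pmf.expectation (p j) (g j) = 0"
  shows "measure_pmf.expectation (Pi_pmf D d p) (\<lambda>z. (\<Sum>j\<in>J. g j (z j))\<^sup>2) =
    (\<Sum>j\<in>J. measure_pmf.expectation (p j) (\<lambda>z. (g j z)\<^sup>2))"
proof -
  let ?P = "Pi_pmf D d p"
  have fin: "finite J" using D finite_subset by blast
  have int: "integrable (measure_pmf ?P) f" for f :: "('a \<Rightarrow> bool) \<Rightarrow> real"
  proof (rule integrable_measure_pmf_finite)
    have "set_pmf ?P \<subseteq> PiE_dflt D d (\<lambda>_. UNIV)"
      using set_Pi_pmf_subset[OF D(1), of d p] by (auto simp: PiE_dflt_def)
    then show "finite (set_pmf ?P)"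
      by (rule finite_subset) (use D in auto)
  qed
  have "measure_pmf.expectation ?P (\<lambda>z. (\<Sum>j\<in>J. g j (z j))\<^sup>2) =
    (\<Sum>j\<in>J. \<Sum>k\<in>J. measure_pmf.expectation ?P (\<lambda>z. g j (z j) * g k (z k)))"
    by (simp add: power2_eq_square sum_product int)
  also have "\<dots> = (\<Sum>j\<in>J. \<Sum>k\<in>J. if k = j then measure_pmf.expectation (p j) (\<lambda>z. (g j z)\<^sup>2) else 0)"
  proof (intro sum.cong refl)
    fix j k assume jk: "j \<in> J" "k \<in> J"
    show "measure_pmf.expectation ?P (\<lambda>z. g j (z j) * g k (z k)) =
      (if k = j then measure_pmf.expectation (p j) (\<lambda>z. (g j z)\<^sup>2) else 0)"
    proof (cases "k = j")
      case True
      have "measure_pmf.expectation ?P (\<lambda>z. (g j (z j))\<^sup>2) =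
        measure_pmf.expectation (map_pmf (\<lambda>z. z j) ?P) (\<lambda>z. (g j z)\<^sup>2)"
        by simp
      also have "map_pmf (\<lambda>z. z j) ?P = p j"
        using D jk by (subst Pi_pmf_component) auto
      finally show ?thesis using True by (simp add: power2_eq_square)
    next
      case False
      have "measure_pmf.expectation ?P (\<lambda>z. g j (z j) * g k (z k)) =
        measure_pmf.expectation (map_pmf (\<lambda>f. (f j, f k)) ?P) (\<lambda>(a, b). g j a * g k b)"
        by simp
      also have "map_pmf (\<lambda>f. (f j, f k)) ?P = pair_pmf (p j) (p k)"
        using D jk False by (intro Pi_pmf_pair_components) auto
      also have "measure_pmf.expectation (pair_pmf (p j) (p k)) (\<lambda>(a, b). g j a * g k b) =
        measure_pmf.expectation (p j) (g j) * measure_pmf.expectation (p k) (g k)"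
        by (subst (1 2 3) integral_measure_pmf_real[where A = UNIV])
           (auto simp: UNIV_Times_UNIV[symmetric] UNIV_bool sum.cartesian_product[symmetric]
              pmf_pair algebra_simps simp del: UNIV_Times_UNIV)
      finally show ?thesis using False zero[OF jk(1)] by simp
    qed
  qed
  also have "\<dots> = (\<Sum>j\<in>J. measure_pmf.expectation (p j) (\<lambda>z. (g j z)\<^sup>2))"
    using fin by simp
  finally show ?thesis .
qed

text \<open>Only improbable words are excluded, which is what limits the number of typical words.
  The slack \<open>\<delta>\<close> is for the whole word, not per bit.\<close>

definition typical :: "'a set \<Rightarrow> ('a \<Rightarrow> real) \<Rightarrow> real \<Rightarrow> ('a \<Rightarrow> bool) \<Rightarrow> bool" where
  "typical J p \<delta> e \<longleftrightarrow>
     2 powr - ((\<Sum>j\<in>J. binary_entropy (p j)) + \<delta>) \<le> (\<Prod>j\<in>J. pmf (bernoulli_pmf (p j)) (e j))"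

lemma typical_cong:
  assumes "\<And>j. j \<in> J \<Longrightarrow> e j = e' j"
  shows "typical J p \<delta> e \<longleftrightarrow> typical J p \<delta> e'"
  using assms by (simp add: typical_def cong: prod.cong)

text \<open>The probability of each typical word is bounded below, and these probabilities sum to at
  most 1.\<close>

lemma card_typical_le:
  assumes J: "finite J"
  shows "real (card {e \<in> PiE_dflt J False (\<lambda>_. UNIV). typical J p \<delta> e})
    \<le> 2 powr ((\<Sum>j\<in>J. binary_entropy (p j)) + \<delta>)"
proof -
  let ?T = "{e \<in> PiE_dflt J False (\<lambda>_. UNIV). typical J p \<delta> e}"
  let ?h = "(\<Sum>j\<in>J. binary_entropy (p j)) + \<delta>"
  let ?P = "Pi_pmf J False (\<lambda>j. bernoulli_pmf (p j))"
  have fin: "finite ?T"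
    by (rule finite_subset[of _ "PiE_dflt J False (\<lambda>_. UNIV)"]) (use J in auto)
  have "real (card ?T) * 2 powr - ?h = (\<Sum>e\<in>?T. 2 powr - ?h)"
    by simp
  also have "\<dots> \<le> (\<Sum>e\<in>?T. pmf ?P e)"
    using J by (intro sum_mono) (auto simp: pmf_Pi typical_def PiE_dflt_def)
  also have "\<dots> = measure_pmf.prob ?P ?T"
    using fin by (simp add: measure_measure_pmf_finite)
  also have "\<dots> \<le> 1" by simp
  finally show ?thesis
    by (simp only: powr_minus) (simp add: field_simps)
qed

text \<open>Chebyshev's inequality for the sum of centred surprisals. \<open>D\<close> carries all
  the noise, \<open>J\<close> only the positions a receiver inspects.\<close>

lemma prob_not_typical_le:
  fixes p :: "'a \<Rightarrow> real"
  assumes D: "finite D" "J \<subseteq> D" and p: "\<And>j. j \<in> J \<Longrightarrow> 0 \<le> p j \<and> p j \<le> 1"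
    and \<delta>: "0 < \<delta>"
  shows "measure_pmf.prob (Pi_pmf D False (\<lambda>j. bernoulli_pmf (p j))) {z. \<not> typical J p \<delta> z}
    \<le> (\<Sum>j\<in>J. surprisal_var (p j)) / \<delta>\<^sup>2"
proof -
  let ?P = "Pi_pmf D False (\<lambda>j. bernoulli_pmf (p j))"
  define S where "S z = (\<Sum>j\<in>J. surprisal (p j) (z j) - binary_entropy (p j))" for z
  have fin: "finite J" using D finite_subset by blast
  \<comment> \<open>On the support all factors are positive, so the logarithm of the product is a
    sum and an atypical word must have \<open>S z\<close> at least \<open>\<delta>\<close>.\<close>
  have good: "typical J p \<delta> z" if z: "z \<in> set_pmf ?P" and S: "S z < \<delta>" for z
  proof -
    have pos: "0 < pmf (bernoulli_pmf (p j)) (z j)" if "j \<in> J" for j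
      using z that D by (auto simp: set_Pi_pmf PiE_dflt_def pmf_positive_iff)
    have "log 2 (\<Prod>j\<in>J. pmf (bernoulli_pmf (p j)) (z j)) = (\<Sum>j\<in>J. log 2 (pmf (bernoulli_pmf (p j)) (z j)))"
      using fin pos
    proof (induction J rule: finite_induct)
      case (insert j J)
      then show ?case by (simp add: log_mult_pos prod_pos)
    qed simp
    also have "\<dots> = - (S z + (\<Sum>j\<in>J. binary_entropy (p j)))"
      by (simp add: S_def surprisal_def sum_subtractf sum_negf)
    finally have *: "- ((\<Sum>j\<in>J. binary_entropy (p j)) + \<delta>) \<le> log 2 (\<Prod>j\<in>J. pmf (bernoulli_pmf (p j)) (z j))"
      using S by simp
    moreover have "0 < (\<Prod>j\<in>J. pmf (bernoulli_pmf (p j)) (z j))"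
      using pos by (intro prod_pos) auto
    ultimately show ?thesis
      unfolding typical_def by (subst (asm) le_log_iff) auto
  qed
  have int: "integrable (measure_pmf ?P) f" for f :: "('a \<Rightarrow> bool) \<Rightarrow> real"
  proof (rule integrable_measure_pmf_finite)
    have "set_pmf ?P \<subseteq> PiE_dflt D False (\<lambda>_. UNIV)"
      using set_Pi_pmf_subset[OF D(1), of False] by (auto simp: PiE_dflt_def)
    then show "finite (set_pmf ?P)"
      by (rule finite_subset) (use D in auto)
  qed
  have "measure_pmf.prob ?P {z. \<not> typical J p \<delta> z} = measure_pmf.prob ?P ({z. \<not> typical J p \<delta> z} \<inter> set_pmf ?P)"
    by (simp add: measure_Int_set_pmf)
  also have "\<dots> \<le> measure_pmf.prob ?P {z \<in> space ?P. \<delta> \<le> \<bar>S z\<bar>}"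
    by (intro measure_pmf.finite_measure_mono) (use good in force)+
  also have "\<dots> \<le> measure_pmf.expectation ?P (\<lambda>z. (S z)\<^sup>2) / \<delta>\<^sup>2"
    by (rule measure_pmf.second_moment_method) (use int \<delta> in auto)
  also have "measure_pmf.expectation ?P (\<lambda>z. (S z)\<^sup>2) = (\<Sum>j\<in>J. surprisal_var (p j))"
    unfolding S_def surprisal_var_def
    by (rule second_moment_sum_Pi_pmf[OF D]) (use p expectation_surprisal in blast)
  finally show ?thesis .
qed

subsection \<open>Random coding\<close>

definition decodable :: "nat \<Rightarrow> ('c \<Rightarrow> 'y \<Rightarrow> bool) \<Rightarrow> (nat \<Rightarrow> 'c) \<Rightarrow> nat \<Rightarrow> 'y \<Rightarrow> bool" where
  "decodable Q good C q y \<longleftrightarrow> (\<forall>q'<Q. good (C q') y \<longleftrightarrow> q' = q)"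

text \<open>Without a unique passing index the value is unspecified; every such case counts as an
  error through \<open>decodable\<close>.\<close>

definition decode :: "nat \<Rightarrow> ('c \<Rightarrow> 'y \<Rightarrow> bool) \<Rightarrow> (nat \<Rightarrow> 'c) \<Rightarrow> 'y \<Rightarrow> nat" where
  "decode Q good C y = (THE q. q < Q \<and> good (C q) y)"

lemma decode_eq:
  assumes "decodable Q good C q y" "q < Q"
  shows "decode Q good C y = q"
  unfolding decode_def using assms by (intro the_equality) (auto simp: decodable_def)

text \<open>Averages of error probabilities become one probability under a composed law, in which
  the order of random draws can be changed.\<close>

lemma expectation_prob_eq_bind:
  "measure_pmf.expectation p (\<lambda>x. measure_pmf.prob (f x) X) = measure_pmf.prob (bind_pmf p f) X"
  by (simp add: measure_pmf_bind measure_pmf.measure_bind[where N = "count_space UNIV"] measure_subprob)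

lemma prob_bind_pmf_le:
  assumes "\<And>x. x \<in> set_pmf p \<Longrightarrow> measure_pmf.prob (f x) X \<le> B"
  shows "measure_pmf.prob (bind_pmf p f) X \<le> B"
  unfolding expectation_prob_eq_bind[symmetric]
  by (rule measure_pmf.integral_le_const)
     (use assms in \<open>auto simp: AE_measure_pmf_iff intro!: measure_pmf.integrable_const_bound[where B = 1]\<close>)

text \<open>Decoding fails only if the true codeword is missed or a rival passes. A rival is uniform
  and independent of the true codeword and the noise, so for each received word it passes with
  probability at most \<open>G\<close>; a union bound covers all rivals.\<close>

lemma expected_decoding_error_le:
  fixes good :: "'c \<Rightarrow> 'y \<Rightarrow> bool" and out :: "'c \<Rightarrow> 'z \<Rightarrow> 'y"
  assumes S: "finite S" "S \<noteq> {}" and q: "q < Q"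
    and noise: "\<And>c. c \<in> S \<Longrightarrow> measure_pmf.prob \<nu> {z. \<not> good c (out c z)} \<le> \<delta>"
    and count: "\<And>y. real (card {c \<in> S. good c y}) \<le> G * real (card S)"
  shows "measure_pmf.expectation (Pi_pmf {..<Q} d (\<lambda>_. pmf_of_set S))
    (\<lambda>C. measure_pmf.prob \<nu> {z. \<not> decodable Q good C q (out (C q) z)}) \<le> \<delta> + real Q * G"
proof -
  let ?P = "Pi_pmf {..<Q} d (\<lambda>_. pmf_of_set S)"
  have int: "integrable (measure_pmf ?P) (\<lambda>C. measure_pmf.prob \<nu> (A C))" for A
    by (rule measure_pmf.integrable_const_bound[where B = 1]) auto
  \<comment> \<open>Nonnegativity of \<open>G\<close> lets the number of rivals be replaced by
    \<open>Q\<close> at the end.\<close>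
  have G: "0 \<le> G"
  proof -
    have "0 \<le> G * real (card S)"
      using count[of undefined] by (rule order_trans[rotated]) simp
    then show ?thesis
      using S by (simp add: zero_le_mult_iff card_gt_0_iff)
  qed
  have miss: "measure_pmf.expectation ?P (\<lambda>C. measure_pmf.prob \<nu> {z. \<not> good (C q) (out (C q) z)}) \<le> \<delta>"
  proof (rule measure_pmf.integral_le_const[OF int])
    have "C q \<in> S" if "C \<in> set_pmf ?P" for C
      using that S q by (auto simp: set_Pi_pmf PiE_dflt_def)
    then show "AE C in ?P. measure_pmf.prob \<nu> {z. \<not> good (C q) (out (C q) z)} \<le> \<delta>"
      using noise by (auto simp: AE_measure_pmf_iff)
  qed
  have clash: "measure_pmf.expectation ?P (\<lambda>C. measure_pmf.prob \<nu> {z. good (C q') (out (C q) z)}) \<le> G"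
    if q': "q' \<in> {..<Q} - {q}" for q'
  proof -
    have "measure_pmf.expectation ?P (\<lambda>C. measure_pmf.prob \<nu> {z. good (C q') (out (C q) z)}) =
      measure_pmf.expectation (map_pmf (\<lambda>C. (C q, C q')) ?P)
        (\<lambda>(c, c'). measure_pmf.prob \<nu> {z. good c' (out c z)})"
      by simp
    also have "map_pmf (\<lambda>C. (C q, C q')) ?P = pair_pmf (pmf_of_set S) (pmf_of_set S)"
      using q q' by (intro Pi_pmf_pair_components) auto
    also have "(\<lambda>(c, c'). measure_pmf.prob \<nu> {z. good c' (out c z)}) =
      (\<lambda>x. measure_pmf.prob (map_pmf (\<lambda>z. good (snd x) (out (fst x) z)) \<nu>) {True})"
      by (auto simp: fun_eq_iff vimage_def)
    also have "measure_pmf.expectation (pair_pmf (pmf_of_set S) (pmf_of_set S)) \<dots> =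
      measure_pmf.prob (bind_pmf (pair_pmf (pmf_of_set S) (pmf_of_set S))
        (\<lambda>x. map_pmf (\<lambda>z. good (snd x) (out (fst x) z)) \<nu>)) {True}"
      by (rule expectation_prob_eq_bind)
    also have "bind_pmf (pair_pmf (pmf_of_set S) (pmf_of_set S))
        (\<lambda>x. map_pmf (\<lambda>z. good (snd x) (out (fst x) z)) \<nu>) =
      bind_pmf (pmf_of_set S) (\<lambda>c. bind_pmf (pmf_of_set S) (\<lambda>c'. bind_pmf \<nu> (\<lambda>z. return_pmf (good c' (out c z)))))"
      by (simp add: pair_pmf_def bind_assoc_pmf bind_return_pmf map_pmf_def)
    \<comment> \<open>Drawing the noise before the rival codeword fixes the received word, so that
      \<open>count\<close> applies.\<close>
    also have "\<dots> = bind_pmf (pmf_of_set S) (\<lambda>c. bind_pmf \<nu> (\<lambda>z. map_pmf (\<lambda>c'. good c' (out c z)) (pmf_of_set S)))"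
      by (subst bind_commute_pmf[of "pmf_of_set S" \<nu>]) (simp add: map_pmf_def)
    also have "measure_pmf.prob \<dots> {True} \<le> G"
    proof (intro prob_bind_pmf_le)
      fix c z
      have "measure_pmf.prob (map_pmf (\<lambda>c'. good c' (out c z)) (pmf_of_set S)) {True} =
        real (card {c' \<in> S. good c' (out c z)}) / real (card S)"
        using S by (auto simp: measure_pmf_of_set vimage_def Int_def)
      also have "\<dots> \<le> G"
        using count[of "out c z"] S by (simp add: divide_le_eq card_gt_0_iff)
      finally show "measure_pmf.prob (map_pmf (\<lambda>c'. good c' (out c z)) (pmf_of_set S)) {True} \<le> G" .
    qed
    finally show ?thesis .
  qed
  have union: "measure_pmf.prob \<nu> {z. \<not> decodable Q good C q (out (C q) z)} \<le>
    measure_pmf.prob \<nu> {z. \<not> good (C q) (out (C q) z)} +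
    (\<Sum>q'\<in>{..<Q} - {q}. measure_pmf.prob \<nu> {z. good (C q') (out (C q) z)})" for C
  proof -
    have "measure_pmf.prob \<nu> {z. \<not> decodable Q good C q (out (C q) z)} \<le>
      measure_pmf.prob \<nu> ({z. \<not> good (C q) (out (C q) z)} \<union>
        (\<Union>q'\<in>{..<Q} - {q}. {z. good (C q') (out (C q) z)}))"
      by (intro measure_pmf.finite_measure_mono) (auto simp: decodable_def)
    also have "\<dots> \<le> measure_pmf.prob \<nu> {z. \<not> good (C q) (out (C q) z)} +
      measure_pmf.prob \<nu> (\<Union>q'\<in>{..<Q} - {q}. {z. good (C q') (out (C q) z)})"
      by (rule measure_Un_le) auto
    also have "measure_pmf.prob \<nu> (\<Union>q'\<in>{..<Q} - {q}. {z. good (C q') (out (C q) z)}) \<le>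
      (\<Sum>q'\<in>{..<Q} - {q}. measure_pmf.prob \<nu> {z. good (C q') (out (C q) z)})"
      by (rule measure_UNION_le) auto
    finally show ?thesis by simp
  qed
  have "measure_pmf.expectation ?P (\<lambda>C. measure_pmf.prob \<nu> {z. \<not> decodable Q good C q (out (C q) z)}) \<le>
    measure_pmf.expectation ?P (\<lambda>C. measure_pmf.prob \<nu> {z. \<not> good (C q) (out (C q) z)} +
      (\<Sum>q'\<in>{..<Q} - {q}. measure_pmf.prob \<nu> {z. good (C q') (out (C q) z)}))"
    by (intro integral_mono union int Bochner_Integration.integrable_add Bochner_Integration.integrable_sum)
  also have "\<dots> = measure_pmf.expectation ?P (\<lambda>C. measure_pmf.prob \<nu> {z. \<not> good (C q) (out (C q) z)}) +
      (\<Sum>q'\<in>{..<Q} - {q}. measure_pmf.expectation ?P (\<lambda>C. measure_pmf.prob \<nu> {z. good (C q') (out (C q) z)}))"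
    by (simp add: int)
  also have "\<dots> \<le> \<delta> + (\<Sum>q'\<in>{..<Q} - {q}. G)"
    by (intro add_mono miss sum_mono clash)
  also have "\<dots> \<le> \<delta> + real Q * G"
    using G card_mono[of "{..<Q}" "{..<Q} - {q}"] by (auto intro!: mult_right_mono)
  finally show ?thesis .
qed

section \<open>Existence of codebooks, in general and for binary symmetric channels\<close>

lemma exists_le_expectation:
  fixes f :: "'a \<Rightarrow> real"
  assumes "integrable (measure_pmf p) f" "measure_pmf.expectation p f \<le> b"
  shows "\<exists>x\<in>set_pmf p. f x \<le> b"
proof (rule ccontr)
  assume "\<not> ?thesis"
  then have gt: "\<And>x. x \<in> set_pmf p \<Longrightarrow> b < f x" by force
  then have "b < measure_pmf.expectation p f"
    by (intro measure_pmf.expectation_greater assms(1)) (auto simp: AE_measure_pmf_iff)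
  then show False using assms(2) by simp
qed

text \<open>The total over all messages and receivers is averaged, so a single codebook does at
  least as well as the average. Messages may share an index \<open>msg w\<close> in any proportion,
  as the bound holds for each fixed index.\<close>

lemma exists_codebook:
  fixes good :: "'i \<Rightarrow> 'c \<Rightarrow> 'y \<Rightarrow> bool" and out :: "'i \<Rightarrow> 'c \<Rightarrow> 'z \<Rightarrow> 'y"
  assumes S: "finite S" "S \<noteq> {}" and w: "\<And>w. w \<in> W \<Longrightarrow> msg w < Q"
    and noise: "\<And>i c. i \<in> I \<Longrightarrow> c \<in> S \<Longrightarrow> measure_pmf.prob \<nu> {z. \<not> good i c (out i c z)} \<le> \<delta> i"
    and count: "\<And>i y. i \<in> I \<Longrightarrow> real (card {c \<in> S. good i c y}) \<le> G i * real (card S)"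
  shows "\<exists>C. (\<Sum>w\<in>W. \<Sum>i\<in>I. measure_pmf.prob \<nu>
      {z. \<not> decodable Q (good i) C (msg w) (out i (C (msg w)) z)})
    \<le> real (card W) * (\<Sum>i\<in>I. \<delta> i + real Q * G i)"
proof -
  let ?P = "Pi_pmf {..<Q} undefined (\<lambda>_. pmf_of_set S)"
  let ?err = "\<lambda>C w i. measure_pmf.prob \<nu> {z. \<not> decodable Q (good i) C (msg w) (out i (C (msg w)) z)}"
  have int: "integrable (measure_pmf ?P) (\<lambda>C. measure_pmf.prob \<nu> (A C))" for A
    by (rule measure_pmf.integrable_const_bound[where B = 1]) auto
  have "measure_pmf.expectation ?P (\<lambda>C. \<Sum>w\<in>W. \<Sum>i\<in>I. ?err C w i) =
    (\<Sum>w\<in>W. \<Sum>i\<in>I. measure_pmf.expectation ?P (\<lambda>C. ?err C w i))"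
    by (simp add: int)
  also have "\<dots> \<le> (\<Sum>w\<in>W. \<Sum>i\<in>I. \<delta> i + real Q * G i)"
    by (intro sum_mono expected_decoding_error_le S w noise count)
  also have "\<dots> = real (card W) * (\<Sum>i\<in>I. \<delta> i + real Q * G i)"
    by simp
  finally have "\<exists>C\<in>set_pmf ?P. (\<Sum>w\<in>W. \<Sum>i\<in>I. ?err C w i)
    \<le> real (card W) * (\<Sum>i\<in>I. \<delta> i + real Q * G i)"
    by (intro exists_le_expectation Bochner_Integration.integrable_sum int)
  then show ?thesis by blast
qed

text \<open>The map \<open>h\<close> names the codeword coordinate seen at a noise position. It will
  be \<open>snd\<close> at a relay, since all relays hear one source word indexed by time, and
  \<open>id\<close> at the destination, whose codewords are indexed by relay and time.\<close>

definition consistent ::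
  "'a set \<Rightarrow> ('a \<Rightarrow> 'b) \<Rightarrow> ('a \<Rightarrow> real) \<Rightarrow> real \<Rightarrow> ('b \<Rightarrow> bool) \<Rightarrow> ('a \<Rightarrow> bool) \<Rightarrow> bool" where
  "consistent J h p \<delta> c y \<longleftrightarrow> typical J p \<delta> (\<lambda>j. c (h j) \<noteq> y j)"

lemma consistent_cong:
  assumes "\<And>j. j \<in> J \<Longrightarrow> y j = y' j"
  shows "consistent J h p \<delta> c y \<longleftrightarrow> consistent J h p \<delta> c y'"
  unfolding consistent_def by (rule typical_cong) (use assms in auto)

text \<open>Adding the fixed word \<open>y\<close> modulo 2 turns consistent codewords into typical
  noise words, injectively because \<open>h\<close> reaches all of \<open>T\<close>.\<close>

lemma card_consistent_le:
  assumes J: "finite J" "h ` J = T"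
  shows "real (card {c \<in> PiE_dflt T False (\<lambda>_. UNIV). consistent J h p \<delta> c y})
    \<le> 2 powr ((\<Sum>j\<in>J. binary_entropy (p j)) + \<delta>)"
proof -
  let ?X = "{c \<in> PiE_dflt T False (\<lambda>_. UNIV). consistent J h p \<delta> c y}"
  let ?Y = "{e \<in> PiE_dflt J False (\<lambda>_. UNIV). typical J p \<delta> e}"
  \<comment> \<open>Outside \<open>J\<close> the noise word is set to \<open>False\<close> to land
    in \<open>PiE_dflt\<close>; typicality looks only at \<open>J\<close>.\<close>
  let ?f = "\<lambda>c j. j \<in> J \<and> (c (h j) \<noteq> y j)"
  have "inj_on ?f ?X"
  proof (rule inj_onI)
    fix c c' assume c: "c \<in> ?X" "c' \<in> ?X" and eq: "?f c = ?f c'"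
    show "c = c'"
    proof
      fix t
      show "c t = c' t"
      proof (cases "t \<in> T")
        case True
        then obtain j where "j \<in> J" "t = h j" using J by auto
        then show ?thesis using fun_cong[OF eq, of j] by auto
      next
        case False
        then show ?thesis using c by (auto simp: PiE_dflt_def)
      qed
    qed
  qed
  moreover have "?f ` ?X \<subseteq> ?Y"
  proof
    fix e assume "e \<in> ?f ` ?X"
    then obtain c where c: "typical J p \<delta> (\<lambda>j. c (h j) \<noteq> y j)" "e = ?f c"
      by (auto simp: consistent_def)
    moreover have "typical J p \<delta> e \<longleftrightarrow> typical J p \<delta> (\<lambda>j. c (h j) \<noteq> y j)"
      by (rule typical_cong) (simp add: c(2))
    ultimately show "e \<in> ?Y" by (auto simp: PiE_dflt_def)
  qed
  moreover have "finite ?Y"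
    by (rule finite_subset[of _ "PiE_dflt J False (\<lambda>_. UNIV)"]) (use J in auto)
  ultimately have "card ?X \<le> card ?Y"
    by (rule card_inj_on_le)
  then show ?thesis
    using card_typical_le[OF J(1), of p \<delta>] by linarith
qed

text \<open>Codewords are uniform among the \<open>2 ^ card T\<close> bit words on \<open>T\<close>,
  so the count of consistent words, divided by this number, bounds the chance that a wrong one
  passes. One codebook serves all receivers in \<open>I\<close>.\<close>

lemma exists_channel_codebook:
  fixes J :: "'i \<Rightarrow> 'a set" and h :: "'i \<Rightarrow> 'a \<Rightarrow> 'b" and p :: "'a \<Rightarrow> real"
  assumes D: "finite D" "\<And>i. i \<in> I \<Longrightarrow> J i \<subseteq> D" and T: "finite T" "\<And>i. i \<in> I \<Longrightarrow> h i ` J i = T"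
    and p: "\<And>j. j \<in> D \<Longrightarrow> 0 \<le> p j \<and> p j \<le> 1" and \<delta>: "0 < \<delta>"
    and w: "\<And>w. w \<in> W \<Longrightarrow> msg w < Q"
  shows "\<exists>C. (\<Sum>w\<in>W. \<Sum>i\<in>I. measure_pmf.prob (Pi_pmf D False (\<lambda>j. bernoulli_pmf (p j)))
      {z. \<not> decodable Q (consistent (J i) (h i) p \<delta>) C (msg w) (\<lambda>j. C (msg w) (h i j) \<noteq> z j)})
    \<le> real (card W) * (\<Sum>i\<in>I. (\<Sum>j\<in>J i. surprisal_var (p j)) / \<delta>\<^sup>2 +
        real Q * 2 powr ((\<Sum>j\<in>J i. binary_entropy (p j)) + \<delta> - real (card T)))"
proof (rule exists_codebook[where S = "PiE_dflt T False (\<lambda>_. UNIV)" and out = "\<lambda>i c z j. c (h i j) \<noteq> z j"])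
  show "finite (PiE_dflt T False (\<lambda>_. UNIV :: bool set))" using T by auto
  show "PiE_dflt T False (\<lambda>_. UNIV :: bool set) \<noteq> {}" by simp
  fix i assume i: "i \<in> I"
  show "measure_pmf.prob (Pi_pmf D False (\<lambda>j. bernoulli_pmf (p j)))
      {z. \<not> consistent (J i) (h i) p \<delta> c (\<lambda>j. c (h i j) \<noteq> z j)}
    \<le> (\<Sum>j\<in>J i. surprisal_var (p j)) / \<delta>\<^sup>2" for c
  proof -
    \<comment> \<open>Adding the codeword twice returns the noise, so the true codeword fails
      exactly when the noise is atypical.\<close>
    have "(\<lambda>j. c (h i j) \<noteq> (c (h i j) \<noteq> z j)) = z" for z by auto
    then show ?thesis
      unfolding consistent_def using prob_not_typical_le[OF D(1) D(2)[OF i], of p \<delta>] p \<delta> D(2)[OF i]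
      by (auto simp: subset_iff)
  qed
  show "real (card {c \<in> PiE_dflt T False (\<lambda>_. UNIV). consistent (J i) (h i) p \<delta> c y})
    \<le> 2 powr ((\<Sum>j\<in>J i. binary_entropy (p j)) + \<delta> - real (card T)) *
      real (card (PiE_dflt T False (\<lambda>_. UNIV :: bool set)))" for y
  proof -
    have "real (card (PiE_dflt T False (\<lambda>_. UNIV :: bool set))) = 2 powr real (card T)"
      using T by (simp add: card_PiE_dflt powr_realpow)
    then have "2 powr ((\<Sum>j\<in>J i. binary_entropy (p j)) + \<delta> - real (card T)) *
      real (card (PiE_dflt T False (\<lambda>_. UNIV :: bool set))) = 2 powr ((\<Sum>j\<in>J i. binary_entropy (p j)) + \<delta>)"
      by (simp add: powr_add[symmetric])
    then show ?thesis
      using card_consistent_le[of "J i" "h i" T p \<delta> y] D i T by (metis finite_subset)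
  qed
qed (use w in auto)

subsection \<open>Block Markov coding\<close>

definition digit :: "nat \<Rightarrow> nat \<Rightarrow> nat \<Rightarrow> nat" where
  "digit Q b w = w div Q ^ b mod Q"

lemma sum_digits:
  assumes "w < Q ^ B"
  shows "(\<Sum>b<B. digit Q b w * Q ^ b) = w"
proof -
  have "(\<Sum>b<B. digit Q b w * Q ^ b) = w mod Q ^ B" for B
  proof (induction B)
    case (Suc B)
    have "w mod Q ^ Suc B = Q ^ B * (w div Q ^ B mod Q) + w mod Q ^ B"
      by (simp add: mod_mult2_eq mult.commute[of Q])
    then show ?case using Suc by (simp add: digit_def)
  qed simp
  then show ?thesis using assms by simp
qed

text \<open>Time starts at 1, so block 0 is \<open>{1..L}\<close> and the block containing
  \<open>t\<close> has index \<open>(t - 1) div L\<close>.\<close>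

definition block :: "nat \<Rightarrow> nat \<Rightarrow> nat set" where
  "block L b = {b * L + 1..b * L + L}"

lemma finite_block [simp]: "finite (block L b)"
  and card_block [simp]: "card (block L b) = L"
  by (simp_all add: block_def)

lemma block_index:
  assumes "t \<in> block L b"
  shows "(t - 1) div L = b"
  by (rule div_nat_eqI) (use assms in \<open>auto simp: block_def mult.commute\<close>)

text \<open>
  Truncated subtraction makes the relays send junk in block \<open>0\<close>, and every encoder sends junk
  after its last block; the destination ignores both.
\<close>

definition block_code ::
  "nat \<Rightarrow> nat \<Rightarrow> nat \<Rightarrow> nat set \<Rightarrow> (nat \<Rightarrow> nat \<Rightarrow> (nat \<Rightarrow> bool) \<Rightarrow> (nat \<times> nat \<Rightarrow> bool) \<Rightarrow> bool)
    \<Rightarrow> (nat \<Rightarrow> (nat \<times> nat \<Rightarrow> bool) \<Rightarrow> (nat \<times> nat \<Rightarrow> bool) \<Rightarrow> bool)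
    \<Rightarrow> (nat \<Rightarrow> nat \<Rightarrow> nat \<Rightarrow> bool) \<Rightarrow> (nat \<Rightarrow> nat \<Rightarrow> nat \<times> nat \<Rightarrow> bool) \<Rightarrow> relay_code" where
  "block_code L B Q W gS gD C D =
     \<lparr>source_enc = (\<lambda>w t. let b = (t - 1) div L in C b (digit Q b w) t),
      relay_enc = (\<lambda>i t vs. let b = (t - 1) div L - 1 in
        D b (decode Q (gS b i) (C b) (\<lambda>(_, s). vs ! (s - 1))) (i, t)),
      dest_dec = (\<lambda>y. let w = (\<Sum>b<B. decode Q (gD b) (D b) y * Q ^ b) in if w \<in> W then w else 0)\<rparr>"

text \<open>Block \<open>b\<close> is over before time \<open>t\<close>, so the relay already holds
  every bit on which its test \<open>gS b i\<close> depends.\<close>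

lemma relay_sent_block_code:
  assumes Q: "0 < Q" and t: "t \<in> block L (Suc b)"
    and cong: "\<And>c y y'. (\<And>s. s \<in> block L b \<Longrightarrow> y (i, s) = y' (i, s)) \<Longrightarrow> gS b i c y \<longleftrightarrow> gS b i c y'"
    and dec: "decodable Q (gS b i) (C b) (digit Q b w) (\<lambda>j. C b (digit Q b w) (snd j) \<noteq> z j)"
  shows "relay_sent (block_code L B Q W gS gD C D) w z i t = D b (digit Q b w) (i, t)"
proof -
  let ?c = "block_code L B Q W gS gD C D"
  let ?v = "\<lambda>(_ :: nat, s). map (relay_received ?c w z i) [1..<t] ! (s - 1)"
  \<comment> \<open>Entry \<open>s - 1\<close> of the list is the bit of time \<open>s\<close>,
    since lists count from 0 and time from 1.\<close>
  have "?v (i, s) = (C b (digit Q b w) (snd (i, s)) \<noteq> z (i, s))" if s: "s \<in> block L b" for s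
  proof -
    have "1 \<le> s" "s < t" using s t by (auto simp: block_def)
    then have "?v (i, s) = relay_received ?c w z i s" by (simp add: nth_map)
    then show ?thesis
      using block_index[OF s] by (simp add: relay_received_def block_code_def Let_def)
  qed
  then have "gS b i c ?v \<longleftrightarrow> gS b i c (\<lambda>j. C b (digit Q b w) (snd j) \<noteq> z j)" for c
    by (intro cong) blast
  then have "decodable Q (gS b i) (C b) (digit Q b w) ?v"
    using dec by (simp only: decodable_def)
  then have "decode Q (gS b i) (C b) ?v = digit Q b w"
    by (rule decode_eq) (use Q in \<open>simp add: digit_def\<close>)
  then show ?thesis
    using block_index[OF t] by (simp add: relay_sent_def block_code_def Let_def)
qed

text \<open>When all relay tests succeed, the relays in \<open>M\<close> send the right joint
  codeword, so \<open>decD\<close>, stated for that ideal codeword, applies to what the destination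
  really receives.\<close>

lemma dest_dec_block_code:
  assumes Q: "0 < Q" and n: "Suc B * L \<le> n" and M: "M \<subseteq> {1..K}" and w: "w \<in> W" "w < Q ^ B"
    and congS: "\<And>b i c y y'. (\<And>s. s \<in> block L b \<Longrightarrow> y (i, s) = y' (i, s)) \<Longrightarrow> gS b i c y \<longleftrightarrow> gS b i c y'"
    and congD: "\<And>b c y y'. (\<And>j. j \<in> M \<times> block L (Suc b) \<Longrightarrow> y j = y' j) \<Longrightarrow> gD b c y \<longleftrightarrow> gD b c y'"
    and decS: "\<And>b i. b < B \<Longrightarrow> i \<in> M \<Longrightarrow>
      decodable Q (gS b i) (C b) (digit Q b w) (\<lambda>j. C b (digit Q b w) (snd j) \<noteq> z j)"
    and decD: "\<And>b. b < B \<Longrightarrow> decodable Q (gD b) (D b) (digit Q b w) (\<lambda>j. D b (digit Q b w) j \<noteq> e j)"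
  shows "dest_dec (block_code L B Q W gS gD C D)
    (dest_received K n (block_code L B Q W gS gD C D) w z e) = w"
proof -
  let ?c = "block_code L B Q W gS gD C D"
  let ?y = "dest_received K n ?c w z e"
  have dec: "decode Q (gD b) (D b) ?y = digit Q b w" if b: "b < B" for b
  proof (rule decode_eq)
    have "?y j = (D b (digit Q b w) j \<noteq> e j)" if j: "j \<in> M \<times> block L (Suc b)" for j
    proof -
      obtain i t where it: "j = (i, t)" "i \<in> M" "t \<in> block L (Suc b)" using j by blast
      \<comment> \<open>Digits reach the destination in blocks 1 to \<open>B\<close>; the last of
        these ends at time \<open>Suc B * L\<close>, within the horizon \<open>n\<close>.\<close>
      have "Suc b * L + L \<le> Suc B * L"
        using mult_le_mono1[of "Suc (Suc b)" "Suc B" L] b by simp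
      then have "j \<in> {1..K} \<times> {1..n}"
        using it M n by (auto simp: block_def)
      then have "?y j = (relay_sent ?c w z i t \<noteq> e j)"
        by (simp add: dest_received_def it(1))
      also have "relay_sent ?c w z i t = D b (digit Q b w) (i, t)"
        by (rule relay_sent_block_code[OF Q it(3)]) (use congS decS[OF b it(2)] in blast)+
      finally show ?thesis by (simp add: it(1))
    qed
    then have "gD b c ?y \<longleftrightarrow> gD b c (\<lambda>j. D b (digit Q b w) j \<noteq> e j)" for c
      by (intro congD) blast
    then show "decodable Q (gD b) (D b) (digit Q b w) ?y"
      using decD[OF b] by (simp only: decodable_def)
    show "digit Q b w < Q" using Q by (simp add: digit_def)
  qed
  then have "(\<Sum>b<B. decode Q (gD b) (D b) ?y * Q ^ b) = (\<Sum>b<B. digit Q b w * Q ^ b)"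
    by (intro sum.cong) auto
  also have "\<dots> = w" by (rule sum_digits) fact
  \<comment> \<open>As \<open>w\<close> is in \<open>W\<close>, the default value 0 of the decoder
    is not taken.\<close>
  finally show ?thesis
    using w by (simp add: block_code_def)
qed

section \<open>Error probability of a block code\<close>

lemma finite_messages [simp]: "finite (messages n R)"
  by (simp add: messages_def)

lemma messages_nonempty [simp]: "messages n R \<noteq> {}"
  by (simp add: messages_def)

lemma zero_in_messages: "0 \<in> messages n R"
  by (simp add: messages_def)

lemma is_code_block_code: "is_code n R (block_code L B Q (messages n R) gS gD C D)"
  using zero_in_messages by (auto simp: is_code_def block_code_def Let_def)

lemma error_prob_eq_sum:
  "error_prob K ps pd n R c = (\<Sum>w\<in>messages n R.
     measure_pmf.prob (pair_pmf (noise_pmf K n ps) (noise_pmf K n pd))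
       {(z, e). dest_dec c (dest_received K n c w z e) \<noteq> w}) / real (card (messages n R))"
proof -
  let ?N = "pair_pmf (noise_pmf K n ps) (noise_pmf K n pd)"
  let ?X = "{(w, z, e). dest_dec c (dest_received K n c w z e) \<noteq> w}"
  have "pair_pmf (pmf_of_set (messages n R)) ?N = bind_pmf (pmf_of_set (messages n R)) (\<lambda>w. map_pmf (Pair w) ?N)"
    by (simp add: pair_pmf_def map_pmf_def)
  then have "error_prob K ps pd n R c =
    measure_pmf.expectation (pmf_of_set (messages n R)) (\<lambda>w. measure_pmf.prob (map_pmf (Pair w) ?N) ?X)"
    by (simp only: error_prob_def expectation_prob_eq_bind)
  also have "\<dots> = (\<Sum>w\<in>messages n R. measure_pmf.prob (map_pmf (Pair w) ?N) ?X) / real (card (messages n R))"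
    by (rule integral_pmf_of_set) auto
  finally show ?thesis
    by (simp add: vimage_def case_prod_unfold)
qed

text \<open>A union bound over blocks and receivers. The destination events are stated for the
  codewords the relays ought to send, so they depend on \<open>e\<close> alone and the relay events
  on \<open>z\<close> alone.\<close>

lemma error_prob_block_code_le:
  fixes C D gS gD L B Q n R
  defines "c \<equiv> block_code L B Q (messages n R) gS gD C D"
  assumes Q: "0 < Q" and n: "Suc B * L \<le> n" and M: "M \<subseteq> {1..K}"
    and W: "\<And>w. w \<in> messages n R \<Longrightarrow> w < Q ^ B"
    and congS: "\<And>b i c y y'. (\<And>s. s \<in> block L b \<Longrightarrow> y (i, s) = y' (i, s)) \<Longrightarrow> gS b i c y \<longleftrightarrow> gS b i c y'"
    and congD: "\<And>b c y y'. (\<And>j. j \<in> M \<times> block L (Suc b) \<Longrightarrow> y j = y' j) \<Longrightarrow> gD b c y \<longleftrightarrow> gD b c y'"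
    and errS: "\<And>b. b < B \<Longrightarrow> (\<Sum>w\<in>messages n R. \<Sum>i\<in>M. measure_pmf.prob (noise_pmf K n ps)
      {z. \<not> decodable Q (gS b i) (C b) (digit Q b w) (\<lambda>j. C b (digit Q b w) (snd j) \<noteq> z j)})
        \<le> real (card (messages n R)) * \<epsilon>S"
    and errD: "\<And>b. b < B \<Longrightarrow> (\<Sum>w\<in>messages n R. measure_pmf.prob (noise_pmf K n pd)
      {e. \<not> decodable Q (gD b) (D b) (digit Q b w) (\<lambda>j. D b (digit Q b w) j \<noteq> e j)})
        \<le> real (card (messages n R)) * \<epsilon>D"
  shows "error_prob K ps pd n R c \<le> real B * (\<epsilon>S + \<epsilon>D)"
proof -
  let ?N = "pair_pmf (noise_pmf K n ps) (noise_pmf K n pd)"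
  let ?W = "messages n R"
  define ES where "ES b w i = {z. \<not> decodable Q (gS b i) (C b) (digit Q b w) (\<lambda>j. C b (digit Q b w) (snd j) \<noteq> z j)}" for b w i
  define ED where "ED b w = {e. \<not> decodable Q (gD b) (D b) (digit Q b w) (\<lambda>j. D b (digit Q b w) j \<noteq> e j)}" for b w
  have fM: "finite M" using M finite_subset by blast
  have pS: "measure_pmf.prob ?N (fst -` E) = measure_pmf.prob (noise_pmf K n ps) E" for E
    by (simp add: measure_map_pmf[symmetric] map_fst_pair_pmf)
  have pD: "measure_pmf.prob ?N (snd -` E) = measure_pmf.prob (noise_pmf K n pd) E" for E
    by (simp add: measure_map_pmf[symmetric] map_snd_pair_pmf)
  have union: "measure_pmf.prob ?N {(z, e). dest_dec c (dest_received K n c w z e) \<noteq> w} \<le>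
    (\<Sum>b<B. (\<Sum>i\<in>M. measure_pmf.prob (noise_pmf K n ps) (ES b w i)) + measure_pmf.prob (noise_pmf K n pd) (ED b w))"
    if w: "w \<in> ?W" for w
  proof -
    have sub: "{(z, e). dest_dec c (dest_received K n c w z e) \<noteq> w} \<subseteq>
      (\<Union>b\<in>{..<B}. (\<Union>i\<in>M. fst -` ES b w i) \<union> snd -` ED b w)"
    proof clarify
      fix z e
      assume err: "dest_dec c (dest_received K n c w z e) \<noteq> w"
      show "(z, e) \<in> (\<Union>b\<in>{..<B}. (\<Union>i\<in>M. fst -` ES b w i) \<union> snd -` ED b w)"
      proof (rule ccontr)
        assume no: "\<not> ?thesis"
        have "decodable Q (gS b i) (C b) (digit Q b w) (\<lambda>j. C b (digit Q b w) (snd j) \<noteq> z j)"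
          if "b < B" "i \<in> M" for b i
          using no that by (auto simp: ES_def)
        moreover have "decodable Q (gD b) (D b) (digit Q b w) (\<lambda>j. D b (digit Q b w) j \<noteq> e j)"
          if "b < B" for b
          using no that by (auto simp: ED_def)
        ultimately have "dest_dec c (dest_received K n c w z e) = w"
          unfolding c_def by (intro dest_dec_block_code[OF Q n M w W[OF w]] congS congD)
        then show False using err by contradiction
      qed
    qed
    have "measure_pmf.prob ?N {(z, e). dest_dec c (dest_received K n c w z e) \<noteq> w} \<le>
      measure_pmf.prob ?N (\<Union>b\<in>{..<B}. (\<Union>i\<in>M. fst -` ES b w i) \<union> snd -` ED b w)"
      by (rule measure_pmf.finite_measure_mono[OF sub]) simp
    also have "\<dots> \<le> (\<Sum>b<B. measure_pmf.prob ?N ((\<Union>i\<in>M. fst -` ES b w i) \<union> snd -` ED b w))"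
      by (rule measure_UNION_le) auto
    also have "\<dots> \<le> (\<Sum>b<B. measure_pmf.prob ?N (\<Union>i\<in>M. fst -` ES b w i) + measure_pmf.prob ?N (snd -` ED b w))"
      by (intro sum_mono measure_Un_le) auto
    also have "\<dots> \<le> (\<Sum>b<B. (\<Sum>i\<in>M. measure_pmf.prob ?N (fst -` ES b w i)) + measure_pmf.prob ?N (snd -` ED b w))"
      by (intro sum_mono add_right_mono measure_UNION_le fM) auto
    finally show ?thesis by (simp only: pS pD)
  qed
  have "(\<Sum>w\<in>?W. measure_pmf.prob ?N {(z, e). dest_dec c (dest_received K n c w z e) \<noteq> w}) \<le>
    (\<Sum>w\<in>?W. \<Sum>b<B. (\<Sum>i\<in>M. measure_pmf.prob (noise_pmf K n ps) (ES b w i)) + measure_pmf.prob (noise_pmf K n pd) (ED b w))"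
    by (intro sum_mono union)
  \<comment> \<open>With the sum over messages innermost, the averaged bounds \<open>errS\<close>
    and \<open>errD\<close> apply block by block.\<close>
  also have "\<dots> = (\<Sum>b<B. (\<Sum>w\<in>?W. \<Sum>i\<in>M. measure_pmf.prob (noise_pmf K n ps) (ES b w i)) +
      (\<Sum>w\<in>?W. measure_pmf.prob (noise_pmf K n pd) (ED b w)))"
    by (subst sum.swap) (simp only: sum.distrib)
  also have "\<dots> \<le> (\<Sum>b<B. real (card ?W) * \<epsilon>S + real (card ?W) * \<epsilon>D)"
    unfolding ES_def ED_def by (intro sum_mono add_mono errS errD) auto
  also have "\<dots> = real B * (\<epsilon>S + \<epsilon>D) * real (card ?W)"
    by (simp add: algebra_simps)
  finally have "(\<Sum>w\<in>?W. measure_pmf.prob ?N {(z, e). dest_dec c (dest_received K n c w z e) \<noteq> w}) \<le>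
    real B * (\<epsilon>S + \<epsilon>D) * real (card ?W)" .
  then show ?thesis
    unfolding error_prob_eq_sum by (simp add: divide_le_eq card_gt_0_iff)
qed

section \<open>Existence of good block codes\<close>

lemma noise_pmf_eq: "noise_pmf K n p = Pi_pmf ({1..K} \<times> {1..n}) False (\<lambda>j. bernoulli_pmf (p (fst j)))"
  by (simp add: noise_pmf_def case_prod_unfold)

lemma sum_fst_Times: "finite T \<Longrightarrow> (\<Sum>j\<in>M \<times> T. f (fst j)) = real (card T) * (\<Sum>i\<in>M. f i :: real)"
  by (simp add: sum.cartesian_product' sum_distrib_left)

text \<open>Each block has its own codebooks: one for the source, shared by all relays in
  \<open>M\<close>, and one joint codebook for the words of all these relays. The joint one makes
  the capacities of the links to the destination add up.\<close>

lemma exists_block_code: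
  assumes ps: "\<And>i. i \<in> {1..K} \<Longrightarrow> 0 \<le> ps i \<and> ps i \<le> 1"
    and pd: "\<And>i. i \<in> {1..K} \<Longrightarrow> 0 \<le> pd i \<and> pd i \<le> 1"
    and M: "M \<subseteq> {1..K}" and \<delta>: "0 < \<delta>" and Q: "0 < Q" and n: "Suc B * L \<le> n"
    and W: "\<And>w. w \<in> messages n R \<Longrightarrow> w < Q ^ B"
  shows "\<exists>c. is_code n R c \<and> error_prob K ps pd n R c \<le> real B *
    ((\<Sum>i\<in>M. real L * surprisal_var (ps i) / \<delta>\<^sup>2 + real Q * 2 powr (real L * binary_entropy (ps i) + \<delta> - real L)) +
     (real L * (\<Sum>i\<in>M. surprisal_var (pd i)) / \<delta>\<^sup>2 +
        real Q * 2 powr (real L * (\<Sum>i\<in>M. binary_entropy (pd i)) + \<delta> - real (card M * L))))"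
proof -
  let ?W = "messages n R"
  let ?D = "{1..K} \<times> {1..n}"
  define gS where "gS b i = consistent ({i} \<times> block L b) snd (\<lambda>j. ps (fst j)) \<delta>" for b i
  define gD where "gD b = consistent (M \<times> block L (Suc b)) id (\<lambda>j. pd (fst j)) \<delta>" for b
  have sub: "block L b \<subseteq> {1..n}" if "b \<le> B" for b
  proof -
    have "b * L + L \<le> Suc B * L" using mult_le_mono1[of "Suc b" "Suc B" L] that by simp
    then have "b * L + L \<le> n" using n by linarith
    then show ?thesis by (auto simp: block_def)
  qed
  define PS where "PS b C \<longleftrightarrow> (\<Sum>w\<in>?W. \<Sum>i\<in>M. measure_pmf.prob (noise_pmf K n ps)
      {z. \<not> decodable Q (gS b i) C (digit Q b w) (\<lambda>j. C (digit Q b w) (snd j) \<noteq> z j)})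
        \<le> real (card ?W) * (\<Sum>i\<in>M. real L * surprisal_var (ps i) / \<delta>\<^sup>2 +
          real Q * 2 powr (real L * binary_entropy (ps i) + \<delta> - real L))" for b C
  have "\<exists>C. PS b C" if b: "b < B" for b
    unfolding PS_def gS_def noise_pmf_eq
    using exists_channel_codebook[where D = ?D and I = M and J = "\<lambda>i. {i} \<times> block L b" and h = "\<lambda>i. snd"
      and p = "\<lambda>j. ps (fst j)" and T = "block L b" and \<delta> = \<delta> and W = ?W and msg = "digit Q b" and Q = Q]
      b sub[of b] M ps \<delta> Q
    by (auto simp: sum_fst_Times[where f = "\<lambda>i. surprisal_var (ps i)"]
        sum_fst_Times[where f = "\<lambda>i. binary_entropy (ps i)"] digit_def subset_iff)
  then obtain C where C: "\<And>b. b < B \<Longrightarrow> PS b (C b)"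
    by metis
  define PD where "PD b D \<longleftrightarrow> (\<Sum>w\<in>?W. measure_pmf.prob (noise_pmf K n pd)
      {e. \<not> decodable Q (gD b) D (digit Q b w) (\<lambda>j. D (digit Q b w) j \<noteq> e j)})
        \<le> real (card ?W) * (real L * (\<Sum>i\<in>M. surprisal_var (pd i)) / \<delta>\<^sup>2 +
          real Q * 2 powr (real L * (\<Sum>i\<in>M. binary_entropy (pd i)) + \<delta> - real (card M * L)))" for b D
  \<comment> \<open>The destination is a single receiver, hence the index set \<open>{()}\<close>;
    digit \<open>b\<close> reaches it in block \<open>Suc b\<close>.\<close>
  have "\<exists>D. PD b D" if b: "b < B" for b
    unfolding PD_def gD_def noise_pmf_eq
    using exists_channel_codebook[where D = ?D and I = "{()}" and J = "\<lambda>i. M \<times> block L (Suc b)" and h = "\<lambda>i. id"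
      and p = "\<lambda>j. pd (fst j)" and T = "M \<times> block L (Suc b)" and \<delta> = \<delta> and W = ?W and msg = "digit Q b" and Q = Q]
      b sub[of "Suc b"] M pd \<delta> Q finite_subset[OF M]
    by (auto simp: sum_fst_Times[where f = "\<lambda>i. surprisal_var (pd i)"]
        sum_fst_Times[where f = "\<lambda>i. binary_entropy (pd i)"] digit_def subset_iff card_cartesian_product)
  then obtain D where D: "\<And>b. b < B \<Longrightarrow> PD b (D b)"
    by metis
  have "error_prob K ps pd n R (block_code L B Q ?W gS gD C D) \<le> real B *
    ((\<Sum>i\<in>M. real L * surprisal_var (ps i) / \<delta>\<^sup>2 + real Q * 2 powr (real L * binary_entropy (ps i) + \<delta> - real L)) +
     (real L * (\<Sum>i\<in>M. surprisal_var (pd i)) / \<delta>\<^sup>2 +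
        real Q * 2 powr (real L * (\<Sum>i\<in>M. binary_entropy (pd i)) + \<delta> - real (card M * L))))"
  proof (rule error_prob_block_code_le[OF Q n M W])
    show "gS b i c y \<longleftrightarrow> gS b i c y'" if "\<And>s. s \<in> block L b \<Longrightarrow> y (i, s) = y' (i, s)" for b i c y y'
      unfolding gS_def by (rule consistent_cong) (use that in auto)
    show "gD b c y \<longleftrightarrow> gD b c y'" if "\<And>j. j \<in> M \<times> block L (Suc b) \<Longrightarrow> y j = y' j" for b c y y'
      unfolding gD_def by (rule consistent_cong) (use that in auto)
  qed (use C D in \<open>simp_all only: PS_def PD_def\<close>)
  then show ?thesis
    using is_code_block_code by (intro exI conjI)
qed

subsection \<open>Choice of parameters\<close>

text \<open>The excess \<open>\<eta>\<close> in the digit rate pays for two losses, each at most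
  half of \<open>\<eta> * B * L\<close>: the additional block of delay (hypothesis \<open>B\<close>)
  and the fewer than \<open>Suc B\<close> time steps left over after the blocks (hypothesis
  \<open>L\<close>).\<close>

lemma message_less_power:
  fixes R \<eta> :: real and B L n :: nat
  assumes R: "0 \<le> R" and B: "2 * R \<le> \<eta> * B" and L: "2 * (Suc B * R) \<le> \<eta> * B * L"
    and n: "n < Suc B * Suc L" and Q: "2 powr (L * (R + \<eta>)) \<le> real Q"
    and w: "w \<in> messages n R"
  shows "w < Q ^ B"
proof -
  have "real n * R \<le> (Suc B * Suc L) * R"
    using n R by (intro mult_right_mono) (simp_all add: of_nat_mono less_imp_le del: of_nat_mult)
  also have "\<dots> = L * B * R + L * R + Suc B * R"
    by (simp add: algebra_simps)
  also have "\<dots> \<le> L * B * R + L * (\<eta> * B / 2) + \<eta> * B * L / 2"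
    using B L by (intro add_mono mult_left_mono) auto
  also have "\<dots> = L * (R + \<eta>) * B"
    by (simp add: algebra_simps)
  finally have "2 powr (real n * R) \<le> 2 powr (L * (R + \<eta>) * B)"
    by simp
  also have "\<dots> = (2 powr (L * (R + \<eta>))) ^ B"
    by (simp add: powr_powr[symmetric] powr_realpow)
  also have "\<dots> \<le> real Q ^ B"
    using Q by (intro power_mono) auto
  finally have le: "2 powr (real n * R) \<le> real (Q ^ B)" by simp
  \<comment> \<open>An integer below the ceiling of a real number is below that number.\<close>
  have "real w < 2 powr (real n * R)"
    using w by (auto simp: messages_def zless_nat_eq_int_zless less_ceiling_iff)
  then show ?thesis using le by linarith
qed

text \<open>The gap \<open>3 * \<eta>\<close> is spent in equal shares: on the digit rate
  \<open>R + \<eta>\<close>, on the typicality slack \<open>L * \<eta>\<close>, and on the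
  exponential decay of the probability that a wrong codeword passes.\<close>

lemma exists_block_code_rate:
  fixes R \<eta> :: real and B L n :: nat
  assumes ps: "\<And>i. i \<in> {1..K} \<Longrightarrow> 0 \<le> ps i \<and> ps i \<le> 1"
    and pd: "\<And>i. i \<in> {1..K} \<Longrightarrow> 0 \<le> pd i \<and> pd i \<le> 1"
    and M: "M \<subseteq> {1..K}" and R: "0 \<le> R" and \<eta>: "0 < \<eta>"
    and RS: "\<And>i. i \<in> M \<Longrightarrow> R + 3 * \<eta> \<le> 1 - binary_entropy (ps i)"
    and RD: "R + 3 * \<eta> \<le> (\<Sum>i\<in>M. 1 - binary_entropy (pd i))"
    and B: "2 * R \<le> \<eta> * B" and L: "2 * (Suc B * R) \<le> \<eta> * B * L" "0 < L"
    and n: "Suc B * L \<le> n" "n < Suc B * Suc L"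
  shows "\<exists>c. is_code n R c \<and> error_prob K ps pd n R c \<le> real B *
    ((\<Sum>i\<in>M. surprisal_var (ps i) / \<eta>\<^sup>2 / L + 2 * (2 powr - \<eta>) ^ L) +
     ((\<Sum>i\<in>M. surprisal_var (pd i)) / \<eta>\<^sup>2 / L + 2 * (2 powr - \<eta>) ^ L))"
proof -
  define Q where "Q = nat \<lceil>2 powr (L * (R + \<eta>))\<rceil>"
  have x1: "1 \<le> 2 powr (L * (R + \<eta>))"
    using R \<eta> by (intro ge_one_powr_ge_zero) auto
  have Qge: "2 powr (L * (R + \<eta>)) \<le> real Q"
    unfolding Q_def by linarith
  \<comment> \<open>Rounding up costs at most a factor 2 because the power is at least 1.\<close>
  have Qle: "real Q \<le> 2 * 2 powr (L * (R + \<eta>))"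
    using x1 unfolding Q_def by linarith
  have Q: "0 < Q" using x1 Qge by linarith
  \<comment> \<open>Here \<open>h\<close> is the noise entropy seen by a receiver in one block and
    \<open>d\<close> the length of its codeword.\<close>
  have clash: "real Q * 2 powr (h + L * \<eta> - d) \<le> 2 * (2 powr - \<eta>) ^ L"
    if "L * (R + 3 * \<eta>) \<le> d - h" for h d :: real
  proof -
    have "real Q * 2 powr (h + L * \<eta> - d) \<le> 2 * 2 powr (L * (R + \<eta>)) * 2 powr (h + L * \<eta> - d)"
      using Qle by (intro mult_right_mono) auto
    also have "\<dots> = 2 * 2 powr (L * (R + \<eta>) + (h + L * \<eta> - d))"
      by (simp add: powr_add)
    also have "\<dots> \<le> 2 * 2 powr (- \<eta> * L)"
      using that by (simp add: algebra_simps)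
    also have "\<dots> = 2 * (2 powr - \<eta>) ^ L"
      by (simp only: powr_powr[symmetric]) (simp add: powr_realpow)
    finally show ?thesis .
  qed
  \<comment> \<open>The variance grows like \<open>L\<close> and the squared slack like the square
    of \<open>L\<close>, which gives the O(1/L) bound.\<close>
  have cheb: "L * v / (L * \<eta>)\<^sup>2 = v / \<eta>\<^sup>2 / L" for v :: real
    using L \<eta> by (simp add: power2_eq_square field_simps)
  have pos: "0 < L * \<eta>" using L \<eta> by simp
  obtain c where c: "is_code n R c" and err: "error_prob K ps pd n R c \<le> real B *
    ((\<Sum>i\<in>M. L * surprisal_var (ps i) / (L * \<eta>)\<^sup>2 + real Q * 2 powr (L * binary_entropy (ps i) + L * \<eta> - L)) +
     (L * (\<Sum>i\<in>M. surprisal_var (pd i)) / (L * \<eta>)\<^sup>2 +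
        real Q * 2 powr (L * (\<Sum>i\<in>M. binary_entropy (pd i)) + L * \<eta> - real (card M * L))))"
    using exists_block_code[where ps = ps and pd = pd and R = R and \<delta> = "L * \<eta>", OF ps pd M pos Q n(1)
      message_less_power[OF R B L(1) n(2) Qge]]
    by blast
  note err
  also have "real B *
    ((\<Sum>i\<in>M. L * surprisal_var (ps i) / (L * \<eta>)\<^sup>2 + real Q * 2 powr (L * binary_entropy (ps i) + L * \<eta> - L)) +
     (L * (\<Sum>i\<in>M. surprisal_var (pd i)) / (L * \<eta>)\<^sup>2 +
        real Q * 2 powr (L * (\<Sum>i\<in>M. binary_entropy (pd i)) + L * \<eta> - real (card M * L)))) \<le> real B *
    ((\<Sum>i\<in>M. surprisal_var (ps i) / \<eta>\<^sup>2 / L + 2 * (2 powr - \<eta>) ^ L) +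
     ((\<Sum>i\<in>M. surprisal_var (pd i)) / \<eta>\<^sup>2 / L + 2 * (2 powr - \<eta>) ^ L))"
    unfolding cheb
  proof (intro mult_left_mono add_mono sum_mono clash order_refl)
    fix i assume "i \<in> M"
    from mult_left_mono[OF RS[OF this], of L]
    show "L * (R + 3 * \<eta>) \<le> L - L * binary_entropy (ps i)"
      by (simp add: right_diff_distrib)
  next
    from mult_left_mono[OF RD, of L]
    show "L * (R + 3 * \<eta>) \<le> real (card M * L) - L * (\<Sum>i\<in>M. binary_entropy (pd i))"
      by (simp add: sum_subtractf right_diff_distrib mult.commute)
  qed auto
  finally show ?thesis using c by blast
qed

theorem theorem6:
  fixes K :: nat and ps pd :: "nat \<Rightarrow> real" and M :: "nat set"
    and pu :: "bool pmf" and px :: "nat \<Rightarrow> bool pmf" and R :: real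
  assumes "1 \<le> K"
    and "\<And>i. i \<in> {1..K} \<Longrightarrow> 0 \<le> ps i \<and> ps i \<le> 1/2"
    and "\<And>i. i \<in> {1..K} \<Longrightarrow> 0 \<le> pd i \<and> pd i \<le> 1/2"
    and "M \<subseteq> {1..K}" and "M \<noteq> {}"
    and "0 \<le> R" and "R < R_D ps pd M pu px"
  shows "achievable K ps pd R"
proof -
  have ps: "0 \<le> ps i \<and> ps i \<le> 1" and pd: "0 \<le> pd i \<and> pd i \<le> 1" if "i \<in> {1..K}" for i
    using assms(2,3)[OF that] by auto
  have fM: "finite M" using assms(4) finite_subset by blast
  note le = R_D_le[OF fM assms(5), where ps = ps and pd = pd and pu = pu and px = px]
  define \<eta> where "\<eta> = (R_D ps pd M pu px - R) / 3"
  have \<eta>: "0 < \<eta>" using assms(7) by (simp add: \<eta>_def)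
  have R: "R + 3 * \<eta> = R_D ps pd M pu px" by (simp add: \<eta>_def field_simps)
  have RS: "R + 3 * \<eta> \<le> 1 - binary_entropy (ps i)" if "i \<in> M" for i
    unfolding R using le(1) ps pd that assms(4) by blast
  have RD: "R + 3 * \<eta> \<le> (\<Sum>i\<in>M. 1 - binary_entropy (pd i))"
    unfolding R using le(2) ps pd assms(4) by blast
  \<comment> \<open>The number of blocks depends only on \<open>R\<close> and \<open>\<eta>\<close>
    and stays fixed as \<open>n\<close> grows; the summand 1 makes it positive.\<close>
  obtain B :: nat where B': "2 * R / \<eta> + 1 \<le> B"
    using real_arch_simple by blast
  then have B: "2 * R \<le> \<eta> * B" and "0 < B"
  proof -
    have "0 \<le> 2 * R / \<eta>" using assms(6) \<eta> by simp
    then show "0 < B" using B' by linarith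
    have "2 * R / \<eta> \<le> B" using B' by linarith
    then show "2 * R \<le> \<eta> * B" using \<eta> by (simp add: field_simps)
  qed
  define F where "F L = real B *
    ((\<Sum>i\<in>M. surprisal_var (ps i) / \<eta>\<^sup>2 / L + 2 * (2 powr - \<eta>) ^ L) +
     ((\<Sum>i\<in>M. surprisal_var (pd i)) / \<eta>\<^sup>2 / L + 2 * (2 powr - \<eta>) ^ L))" for L :: nat
  have "2 powr - \<eta> < 2 powr 0"
    using \<eta> by (intro powr_less_mono) auto
  then have pow: "(\<lambda>L. (2 powr - \<eta>) ^ L) \<longlonglongrightarrow> 0"
    by (intro LIMSEQ_realpow_zero) auto
  \<comment> \<open>With \<open>B\<close> and \<open>M\<close> fixed, finitely many terms each tend
    to 0 with the block length.\<close>
  have "F \<longlonglongrightarrow> real B * ((\<Sum>i\<in>M. 0 + 2 * 0) + (0 + 2 * 0))"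
    unfolding F_def by (intro tendsto_intros pow lim_const_over_n)
  then have F: "F \<longlonglongrightarrow> 0" by simp
  have div: "filterlim (\<lambda>n. n div Suc B) at_top sequentially"
    unfolding filterlim_at_top
  proof
    fix Z show "\<forall>\<^sub>F n in sequentially. Z \<le> n div Suc B"
      using eventually_ge_at_top[of "Z * Suc B"]
      by eventually_elim (simp add: less_eq_div_iff_mult_less_eq del: mult_Suc_right)
  qed
  \<comment> \<open>The block length is \<open>n div Suc B\<close>: the \<open>B + 1\<close> blocks
    fit into \<open>n\<close>, and the remainder is shorter than \<open>Suc B\<close>. It tends to
    infinity with \<open>n\<close>, so every large \<open>n\<close> is covered.\<close>
  have code: "\<exists>c. is_code n R c \<and> error_prob K ps pd n R c \<le> F (n div Suc B)"
    if L: "2 * (Suc B * R) / (\<eta> * B) \<le> n div Suc B" "0 < n div Suc B" for n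
    unfolding F_def
  proof (rule exists_block_code_rate[OF ps pd assms(4,6) \<eta> RS RD B _ L(2)])
    show "2 * (Suc B * R) \<le> \<eta> * B * (n div Suc B)"
      using L(1) \<eta> \<open>0 < B\<close> by (simp add: pos_divide_le_eq mult.commute)
    show "Suc B * (n div Suc B) \<le> n" by (rule times_div_less_eq_dividend)
    show "n < Suc B * Suc (n div Suc B)" using dividend_less_times_div[of "Suc B" n] by simp
  qed
  show ?thesis
    unfolding achievable_def
  proof (intro conjI allI impI assms(6))
    fix \<epsilon> :: real assume "0 < \<epsilon>"
    then have "\<forall>\<^sub>F L in sequentially. F L < \<epsilon>"
      using F by (rule order_tendstoD(2)[rotated])
    moreover have "\<forall>\<^sub>F L in sequentially. 2 * (Suc B * R) / (\<eta> * B) \<le> real L"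
      using filterlim_real_sequentially unfolding filterlim_at_top by blast
    ultimately have "\<forall>\<^sub>F L in sequentially. F L < \<epsilon> \<and> 2 * (Suc B * R) / (\<eta> * B) \<le> real L \<and> 0 < L"
      using eventually_gt_at_top[of 0] by eventually_elim auto
    then have "\<forall>\<^sub>F n in sequentially. F (n div Suc B) < \<epsilon> \<and>
        2 * (Suc B * R) / (\<eta> * B) \<le> real (n div Suc B) \<and> 0 < n div Suc B"
      using div by (rule eventually_compose_filterlim)
    then show "\<forall>\<^sub>F n in sequentially. \<exists>c. is_code n R c \<and> error_prob K ps pd n R c < \<epsilon>"
    proof eventually_elim
      case (elim n)
      then show ?case using code[of n] by (meson le_less_trans)
    qed
  qed
qed

end
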